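(* Consider the non-interactive imitation learning setting, where a (possibly randomized) learning algorithm $\mathrm{Alg}$ receives a dataset $\mathcal{D}$ of $N$ trajectories generated by a Nash equilibrium pair $(\mu^{E},\nu^{E})$ of a two-player zero-sum Markov game with unknown reward and outputs a policy pair $(\widehat\mu,\widehat\nu)$. For any such learning algorithm $\mathrm{Alg}$ there exists a two-player zero-sum Markov game, with a Nash equilibrium expert pair $(\mu^{E},\nu^{E})$ satisfying $\mathcal{C}(\mu^{E},\nu^{E})=\infty$, such that the output policies satisfy $$\mathbb{E}_{\mathrm{Alg}}\big[\langle d_0,\,V^{\mu^\star,\widehat\nu}-V^{\widehat\mu,\nu^\star}\rangle\big]\;\ge\;(1-\gamma)^{-1},\qquad \mu^\star\in\mathrm{br}(\widehat\nu),\ \nu^\star\in\mathrm{br}(\widehat\mu).$$ The result continues to hold even if $\mathrm{Alg}$ is aware of the transition dynamics $P$ of the game.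
   Context: A two-player zero-sum Markov game $\mathcal{G}=(\mathcal{S},\mathcal{A},\mathcal{B},P,r,\gamma,d_0)$ has finite state space $\mathcal{S}$, finite action spaces $\mathcal{A}$ (player 1, maximizing) and $\mathcal{B}$ (player 2, minimizing), transition kernel $P(s'\mid s,a,b)$, reward $r(s,a,b)\in[-1,1]$, discount factor $\gamma\in[0,1)$ and initial state distribution $d_0$. Policies are stationary maps $\mu:\mathcal{S}\to\Delta_{\mathcal{A}}$, $\nu:\mathcal{S}\to\Delta_{\mathcal{B}}$. For $(\mu,\nu)$ generating $(S_t,A_t,B_t)_{t\ge0}$: $V^{\mu,\nu}(s)=\mathbb{E}_{\mu,\nu}[\sum_{t\ge0}\gamma^t r(S_t,A_t,B_t)\mid S_0=s]$ and $d^{\mu,\nu}(s)=(1-\gamma)\mathbb{E}_{\mu,\nu}[\sum_{t\ge0}\gamma^t\mathbf{1}_{\{S_t=s\}}\mid S_0\sim d_0]$. Best responses: $\mathrm{br}(\nu)=\arg\max_\mu\langle d_0,V^{\mu,\nu}\rangle$, $\mathrm{br}(\mu)=\arg\min_\nu\langle d_0,V^{\mu,\nu}\rangle$. $(\mu,\nu)$ is a Nash equilibrium if $\mu\in\mathrm{br}(\nu)$ and $\nu\in\mathrm{br}(\mu)$. Expert policy deviation concentrability coefficient: $$\mathcal{C}(\mu^{E},\nu^{E})=\max\Big\{\max_{\mu\in\mathrm{br}(\nu^{E})}\Big\|\frac{d^{\mu,\nu^{E}}}{d^{\mu^{E},\nu^{E}}}\Big\|_\infty,\ \max_{\nu\in\mathrm{br}(\mu^{E})}\Big\|\frac{d^{\mu^{E},\nu}}{d^{\mu^{E},\nu^{E}}}\Big\|_\infty\Big\},$$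 with pointwise ratios and the conventions $0/0=0$, $x/0=\infty$ for $x>0$. Non-interactive setting: $\mathcal{D}=\{\tau_k\}_{k=1}^N$ consists of independent trajectories; for each, a random length $H\sim\mathrm{Geo}(1-\gamma)$ is drawn and the states and joint actions of the first $H$ time steps of the interaction of $(\mu^{E},\nu^{E})$ with the game started from $d_0$ are recorded. After $\mathcal{D}$ is collected, no further expert data can be obtained, and the reward $r$ is never revealed. Thus the output of $\mathrm{Alg}$ is a (possibly random) function of $\mathcal{D}$ and of the known elements of the game (state and action spaces, $\gamma$, $d_0$, and, in the last sentence of the claim, also $P$). $\mathbb{E}_{\mathrm{Alg}}$ is the expectation over the dataset and the internal randomness of $\mathrm{Alg}$. *)

theory Defs
  imports "HOL-Probability.Probability"
begin

section \<open>Zero-sum Markov games\<close>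

text \<open>The records are nested by what a learner may know: \<open>env\<close> holds the state and action spaces, the
  discount factor and the initial distribution, \<open>dyn\<close> adds the transition kernel, and \<open>game\<close>
  adds the reward. Only the values on the carrier sets matter. Player 1 maximizes.\<close>

record ('s, 'a, 'b) env =
  states :: "'s set"
  actions1 :: "'a set"
  actions2 :: "'b set"
  disc :: real
  init :: "'s pmf"

record ('s, 'a, 'b) dyn = "('s, 'a, 'b) env" +
  trans :: "'s \<Rightarrow> 'a \<Rightarrow> 'b \<Rightarrow> 's pmf"

record ('s, 'a, 'b) game = "('s, 'a, 'b) dyn" +
  reward :: "'s \<Rightarrow> 'a \<Rightarrow> 'b \<Rightarrow> real"

definition markov_game :: "('s, 'a, 'b) game \<Rightarrow> bool" where
  "markov_game G \<longleftrightarrow>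
     finite (states G) \<and> states G \<noteq> {} \<and>
     finite (actions1 G) \<and> actions1 G \<noteq> {} \<and>
     finite (actions2 G) \<and> actions2 G \<noteq> {} \<and>
     0 \<le> disc G \<and> disc G < 1 \<and>
     set_pmf (init G) \<subseteq> states G \<and>
     (\<forall>s\<in>states G. \<forall>a\<in>actions1 G. \<forall>b\<in>actions2 G.
        set_pmf (trans G s a b) \<subseteq> states G \<and> -1 \<le> reward G s a b \<and> reward G s a b \<le> 1)"

definition policies :: "'s set \<Rightarrow> 'a set \<Rightarrow> ('s \<Rightarrow> 'a pmf) set" where
  "policies S A = S \<rightarrow>\<^sub>E {p. set_pmf p \<subseteq> A}"

section \<open>The interaction process\<close>

definition play_from ::
    "('s \<Rightarrow> 'a pmf) \<Rightarrow> ('s \<Rightarrow> 'b pmf) \<Rightarrow> 's pmf \<Rightarrow> ('s \<times> 'a \<times> 'b) pmf" where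
  "play_from \<mu> \<nu> \<rho> =
     bind_pmf \<rho> (\<lambda>s. bind_pmf (\<mu> s) (\<lambda>a. bind_pmf (\<nu> s) (\<lambda>b. return_pmf (s, a, b))))"

text \<open>Law of \<open>(S\<^sub>n, A\<^sub>n, B\<^sub>n)\<close> given the history \<open>\<omega>\<close> up to time \<open>n - 1\<close>, where \<open>S\<^sub>0\<close> has law \<open>\<rho>\<close>.\<close>

fun kernel :: "('s, 'a, 'b) game \<Rightarrow> ('s \<Rightarrow> 'a pmf) \<Rightarrow> ('s \<Rightarrow> 'b pmf) \<Rightarrow> 's pmf \<Rightarrow>
    nat \<Rightarrow> (nat \<Rightarrow> 's \<times> 'a \<times> 'b) \<Rightarrow> ('s \<times> 'a \<times> 'b) pmf" where
  "kernel G \<mu> \<nu> \<rho> 0 \<omega> = play_from \<mu> \<nu> \<rho>"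
| "kernel G \<mu> \<nu> \<rho> (Suc n) \<omega> = (case \<omega> n of (s, a, b) \<Rightarrow> play_from \<mu> \<nu> (trans G s a b))"

lemma Ionescu_Tulcea_kernel:
  "Ionescu_Tulcea (\<lambda>n \<omega>. measure_pmf (kernel G \<mu> \<nu> \<rho> n \<omega>)) (\<lambda>_. count_space UNIV)"
proof
  fix n
  show "(\<lambda>\<omega>. measure_pmf (kernel G \<mu> \<nu> \<rho> n \<omega>))
      \<in> PiM {0..<n} (\<lambda>_. count_space UNIV) \<rightarrow>\<^sub>M subprob_algebra (count_space UNIV)"
  proof (cases n)
    case 0
    then show ?thesis
      by (simp add: measurable_const space_subprob_algebra measure_pmf.subprob_space_axioms)
  next
    case (Suc m)
    have "(\<lambda>x. measure_pmf (case x of (s, a, b) \<Rightarrow> play_from \<mu> \<nu> (trans G s a b)))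
        \<in> count_space UNIV \<rightarrow>\<^sub>M subprob_algebra (count_space UNIV)"
      by (simp add: space_subprob_algebra measure_pmf.subprob_space_axioms)
    moreover have "(\<lambda>\<omega>. \<omega> m) \<in> PiM {0..<n} (\<lambda>_. count_space UNIV) \<rightarrow>\<^sub>M count_space UNIV"
      using Suc by (intro measurable_component_singleton) simp
    ultimately show ?thesis
      using Suc by (simp add: measurable_compose[where g = "\<lambda>x. measure_pmf (case x of (s, a, b) \<Rightarrow> _ s a b)"])
  qed
qed

text \<open>Law of the whole interaction \<open>(S\<^sub>t, A\<^sub>t, B\<^sub>t)\<close>, \<open>t \<ge> 0\<close>, with \<open>S\<^sub>0\<close> of law \<open>\<rho>\<close> (Ionescu-Tulcea).\<close>

definition process :: "('s, 'a, 'b) game \<Rightarrow> ('s \<Rightarrow> 'a pmf) \<Rightarrow> ('s \<Rightarrow> 'b pmf) \<Rightarrow> 's pmf \<Rightarrow>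
    (nat \<Rightarrow> 's \<times> 'a \<times> 'b) measure" where
  "process G \<mu> \<nu> \<rho> =
     projective_family.lim UNIV
       (Ionescu_Tulcea.CI (\<lambda>n \<omega>. measure_pmf (kernel G \<mu> \<nu> \<rho> n \<omega>)) (\<lambda>_. count_space UNIV))
       (\<lambda>_. count_space UNIV)"

definition val :: "('s, 'a, 'b) game \<Rightarrow> ('s \<Rightarrow> 'a pmf) \<Rightarrow> ('s \<Rightarrow> 'b pmf) \<Rightarrow> 's \<Rightarrow> real" where
  "val G \<mu> \<nu> s =
     (\<integral>\<omega>. (\<Sum>t. disc G ^ t * (case \<omega> t of (s', a, b) \<Rightarrow> reward G s' a b))
       \<partial>process G \<mu> \<nu> (return_pmf s))"

definition occ :: "('s, 'a, 'b) game \<Rightarrow> ('s \<Rightarrow> 'a pmf) \<Rightarrow> ('s \<Rightarrow> 'b pmf) \<Rightarrow> 's \<Rightarrow> real" where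
  "occ G \<mu> \<nu> s =
     (1 - disc G) * (\<integral>\<omega>. (\<Sum>t. disc G ^ t * indicator {s} (fst (\<omega> t))) \<partial>process G \<mu> \<nu> (init G))"

definition init_avg :: "('s, 'a, 'b) game \<Rightarrow> ('s \<Rightarrow> real) \<Rightarrow> real" where
  "init_avg G f = (\<Sum>s\<in>states G. pmf (init G) s * f s)"

section \<open>Best responses, Nash equilibria, concentrability\<close>

definition br1 :: "('s, 'a, 'b) game \<Rightarrow> ('s \<Rightarrow> 'b pmf) \<Rightarrow> ('s \<Rightarrow> 'a pmf) set" where
  "br1 G \<nu> = {\<mu> \<in> policies (states G) (actions1 G).
     \<forall>\<mu>' \<in> policies (states G) (actions1 G). init_avg G (val G \<mu>' \<nu>) \<le> init_avg G (val G \<mu> \<nu>)}"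

definition br2 :: "('s, 'a, 'b) game \<Rightarrow> ('s \<Rightarrow> 'a pmf) \<Rightarrow> ('s \<Rightarrow> 'b pmf) set" where
  "br2 G \<mu> = {\<nu> \<in> policies (states G) (actions2 G).
     \<forall>\<nu>' \<in> policies (states G) (actions2 G). init_avg G (val G \<mu> \<nu>) \<le> init_avg G (val G \<mu> \<nu>')}"

definition nash :: "('s, 'a, 'b) game \<Rightarrow> ('s \<Rightarrow> 'a pmf) \<Rightarrow> ('s \<Rightarrow> 'b pmf) \<Rightarrow> bool" where
  "nash G \<mu> \<nu> \<longleftrightarrow> \<mu> \<in> br1 G \<nu> \<and> \<nu> \<in> br2 G \<mu>"

text \<open>Division on \<^typ>\<open>ennreal\<close> satisfies \<open>0 / 0 = 0\<close> and \<open>x / 0 = \<infinity>\<close> for \<open>x > 0\<close>, as required.\<close>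

definition ratio_norm :: "('s, 'a, 'b) game \<Rightarrow> ('s \<Rightarrow> real) \<Rightarrow> ('s \<Rightarrow> real) \<Rightarrow> ennreal" where
  "ratio_norm G d d' = (SUP s\<in>states G. ennreal (d s) / ennreal (d' s))"

definition concentrability ::
    "('s, 'a, 'b) game \<Rightarrow> ('s \<Rightarrow> 'a pmf) \<Rightarrow> ('s \<Rightarrow> 'b pmf) \<Rightarrow> ennreal" where
  "concentrability G \<mu>E \<nu>E =
     max (SUP \<mu>\<in>br1 G \<nu>E. ratio_norm G (occ G \<mu> \<nu>E) (occ G \<mu>E \<nu>E))
         (SUP \<nu>\<in>br2 G \<mu>E. ratio_norm G (occ G \<mu>E \<nu>) (occ G \<mu>E \<nu>E))"

section \<open>Non-interactive imitation learning\<close>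

primrec rollout :: "('s, 'a, 'b) game \<Rightarrow> ('s \<Rightarrow> 'a pmf) \<Rightarrow> ('s \<Rightarrow> 'b pmf) \<Rightarrow>
    nat \<Rightarrow> 's pmf \<Rightarrow> ('s \<times> 'a \<times> 'b) list pmf" where
  "rollout G \<mu> \<nu> 0 \<rho> = return_pmf []"
| "rollout G \<mu> \<nu> (Suc h) \<rho> =
     bind_pmf (play_from \<mu> \<nu> \<rho>)
       (\<lambda>(s, a, b). map_pmf ((#) (s, a, b)) (rollout G \<mu> \<nu> h (trans G s a b)))"

text \<open>\<open>Geo(p)\<close> is the law of the number of trials up to and including the first success, so
  \<open>H \<ge> 1\<close>; the library's \<^const>\<open>geometric_pmf\<close> counts the failures only.\<close>

definition trajectory_pmf ::
    "('s, 'a, 'b) game \<Rightarrow> ('s \<Rightarrow> 'a pmf) \<Rightarrow> ('s \<Rightarrow> 'b pmf) \<Rightarrow> ('s \<times> 'a \<times> 'b) list pmf" where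
  "trajectory_pmf G \<mu> \<nu> =
     bind_pmf (map_pmf Suc (geometric_pmf (1 - disc G))) (\<lambda>H. rollout G \<mu> \<nu> H (init G))"

definition dataset_pmf :: "('s, 'a, 'b) game \<Rightarrow> ('s \<Rightarrow> 'a pmf) \<Rightarrow> ('s \<Rightarrow> 'b pmf) \<Rightarrow> nat \<Rightarrow>
    ('s \<times> 'a \<times> 'b) list list pmf" where
  "dataset_pmf G \<mu> \<nu> N = replicate_pmf N (trajectory_pmf G \<mu> \<nu>)"

text \<open>The Borel sigma-algebra on the set of maps from \<open>S\<close> to the simplex over \<open>A\<close>.\<close>

definition policy_space :: "'s set \<Rightarrow> 'a set \<Rightarrow> ('s \<Rightarrow> 'a pmf) measure" where
  "policy_space S A =
     vimage_algebra (policies S A) (\<lambda>\<mu>. \<lambda>s\<in>S. \<lambda>a\<in>A. pmf (\<mu> s) a)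
       (PiM S (\<lambda>_. PiM A (\<lambda>_. borel :: real measure)))"

text \<open>Randomized outputs: probability measures on pairs of policies. As datasets are discrete, no
  measurability in the dataset is needed for a learner to be a Markov kernel.\<close>

definition random_outputs ::
    "('s, 'a, 'b) game \<Rightarrow> (('s \<Rightarrow> 'a pmf) \<times> ('s \<Rightarrow> 'b pmf)) measure set" where
  "random_outputs G = space (prob_algebra
     (policy_space (states G) (actions1 G) \<Otimes>\<^sub>M policy_space (states G) (actions2 G)))"

text \<open>The expected gap of a learner that answers dataset \<open>D\<close> with \<open>out D\<close>, where \<open>\<mu>s\<close> and \<open>\<nu>s\<close>
  pick best responses to the two outputs. The gap is then nonnegative, so nothing is lost by
  the embedding into \<^typ>\<open>ennreal\<close>.\<close>

definition expected_gap ::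
    "('s, 'a, 'b) game \<Rightarrow> ('s \<Rightarrow> 'a pmf) \<Rightarrow> ('s \<Rightarrow> 'b pmf) \<Rightarrow> nat \<Rightarrow>
     (('s \<times> 'a \<times> 'b) list list \<Rightarrow> (('s \<Rightarrow> 'a pmf) \<times> ('s \<Rightarrow> 'b pmf)) measure) \<Rightarrow>
     (('s \<Rightarrow> 'b pmf) \<Rightarrow> ('s \<Rightarrow> 'a pmf)) \<Rightarrow> (('s \<Rightarrow> 'a pmf) \<Rightarrow> ('s \<Rightarrow> 'b pmf)) \<Rightarrow> ennreal" where
  "expected_gap G \<mu>E \<nu>E N out \<mu>s \<nu>s =
     (\<integral>\<^sup>+D. (\<integral>\<^sup>+(\<mu>, \<nu>). ennreal (init_avg G (\<lambda>s. val G (\<mu>s \<nu>) \<nu> s - val G \<mu> (\<nu>s \<mu>) s)) \<partial>out D)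
        \<partial>measure_pmf (dataset_pmf G \<mu>E \<nu>E N))"

definition best_response_choice ::
    "('s, 'a, 'b) game \<Rightarrow> (('s \<Rightarrow> 'b pmf) \<Rightarrow> ('s \<Rightarrow> 'a pmf)) \<Rightarrow>
     (('s \<Rightarrow> 'a pmf) \<Rightarrow> ('s \<Rightarrow> 'b pmf)) \<Rightarrow> bool" where
  "best_response_choice G \<mu>s \<nu>s \<longleftrightarrow>
     (\<forall>\<nu> \<in> policies (states G) (actions2 G). \<mu>s \<nu> \<in> br1 G \<nu>) \<and>
     (\<forall>\<mu> \<in> policies (states G) (actions1 G). \<nu>s \<mu> \<in> br2 G \<mu>)"

end

theory Submission
  imports Defs
begin

text \<open>Since \<open>N\<close> is fixed before the game, take \<open>M = 3 N + 3\<close> states with uniform initial law, absorbing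
  under the expert: at most \<open>N\<close> of them occur in the data. In each state \<open>0 < s < M\<close> one of four actions, \<open>c s\<close>, is
  hidden; the reward is separable, \<open>[a = c s] - [b = c s]\<close>, so playing \<open>c\<close> is dominant for both
  players. The dynamics do not depend on \<open>c\<close>, and an output loses
  \<open>(2 - \<mu> s (c s) - \<nu> s (c s)) / (1 - \<gamma>)\<close> in state \<open>s\<close>. Averaged over \<open>c s\<close> this is at
  least \<open>3 / 2 / (1 - \<gamma>)\<close> in an unseen state, and at least two thirds of the states are unseen and
  rewarding, so some \<open>c\<close> is as bad as claimed. The state \<open>0\<close> carries no reward, and one action of
  player 1 leads from it to a sink \<open>M\<close> that the expert never reaches: deviating there is still
  a best response, which makes the concentrability infinite.\<close>

section \<open>One-dimensional marginals of the interaction\<close>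

text \<open>Rewards and state indicators look at a single time step, so these discrete laws of (S_n,
  A_n, B_n) are all that values and occupancies need from the measure on infinite plays.\<close>

primrec marginal :: "('s, 'a, 'b) game \<Rightarrow> ('s \<Rightarrow> 'a pmf) \<Rightarrow> ('s \<Rightarrow> 'b pmf) \<Rightarrow> 's pmf \<Rightarrow>
    nat \<Rightarrow> ('s \<times> 'a \<times> 'b) pmf" where
  "marginal G \<mu> \<nu> \<rho> 0 = play_from \<mu> \<nu> \<rho>"
| "marginal G \<mu> \<nu> \<rho> (Suc n) =
     bind_pmf (marginal G \<mu> \<nu> \<rho> n) (\<lambda>(s, a, b). play_from \<mu> \<nu> (trans G s a b))"

lemma prob_space_process: "prob_space (process G \<mu> \<nu> \<rho>)"
proof -
  interpret Ionescu_Tulcea "\<lambda>n \<omega>. measure_pmf (kernel G \<mu> \<nu> \<rho> n \<omega>)" "\<lambda>_. count_space UNIV"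
    by (rule Ionescu_Tulcea_kernel)
  \<comment> \<open>A measure with some image that is a probability measure is itself one; the
    projection to no coordinates already serves.\<close>
  have "distr PF.lim (PiM {} (\<lambda>_. count_space UNIV)) (\<lambda>x. restrict x {}) = CI {}"
    by (rule distr_lim) simp
  then have "prob_space (distr PF.lim (PiM {} (\<lambda>_. count_space UNIV)) (\<lambda>x. restrict x {}))"
    by (simp add: PF.prob_space_P)
  then have "prob_space PF.lim"
    by (rule prob_space_distrD[rotated]) (auto intro!: measurable_restrict)
  then show ?thesis
    by (simp add: process_def)
qed

lemma measurable_process_component [measurable]:
  "(\<lambda>\<omega>. \<omega> n) \<in> process G \<mu> \<nu> \<rho> \<rightarrow>\<^sub>M count_space UNIV"
proof -
  interpret Ionescu_Tulcea "\<lambda>n \<omega>. measure_pmf (kernel G \<mu> \<nu> \<rho> n \<omega>)" "\<lambda>_. count_space UNIV"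
    by (rule Ionescu_Tulcea_kernel)
  show ?thesis
    unfolding process_def by (subst measurable_cong_sets[OF PF.sets_lim refl]) simp
qed

text \<open>The projection of the limit to the first n + 1 coordinates is the composed kernel
  \<open>C 0 (Suc n)\<close>; the law of its last coordinate is found by integrating test
  functions.\<close>

lemma distr_process_component:
  fixes G :: "('s, 'a, 'b) game"
  shows "distr (process G \<mu> \<nu> \<rho>) (count_space UNIV) (\<lambda>\<omega>. \<omega> n) = measure_pmf (marginal G \<mu> \<nu> \<rho> n)"
proof -
  interpret Ionescu_Tulcea "\<lambda>n \<omega>. measure_pmf (kernel G \<mu> \<nu> \<rho> n \<omega>)" "\<lambda>_. count_space UNIV"
    by (rule Ionescu_Tulcea_kernel)
  let ?S = "\<lambda>_::nat. count_space (UNIV :: ('s \<times> 'a \<times> 'b) set)"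
  let ?u = "\<lambda>_::nat. undefined :: 's \<times> 'a \<times> 'b"
  have u: "?u \<in> space (PiM {0..<0} ?S)"
    by (simp add: space_PiM)
  have C_Suc: "(\<integral>\<^sup>+\<omega>. f (\<omega> n) \<partial>C 0 (Suc n) ?u)
      = (\<integral>\<^sup>+\<omega>. (\<integral>\<^sup>+x. f x \<partial>kernel G \<mu> \<nu> \<rho> n \<omega>) \<partial>C 0 n ?u)" for f :: "_ \<Rightarrow> ennreal" and n
  proof -
    have f [measurable]: "(\<lambda>\<omega>. f (\<omega> n)) \<in> borel_measurable (PiM {0..<Suc n} ?S)"
      by (rule measurable_compose[OF measurable_component_singleton[of n]]) auto
    have "(\<integral>\<^sup>+\<omega>. f (\<omega> n) \<partial>C 0 (Suc n) ?u) = (\<integral>\<^sup>+\<omega>. (\<integral>\<^sup>+\<omega>'. f (\<omega>' n) \<partial>eP n \<omega>) \<partial>C 0 n ?u)"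
      unfolding C.simps add_0
      by (rule nn_integral_bind[OF f], subst measurable_cong_sets[OF sets_C[OF u] refl]) simp
    also have "\<dots> = (\<integral>\<^sup>+\<omega>. (\<integral>\<^sup>+x. f x \<partial>kernel G \<mu> \<nu> \<rho> n \<omega>) \<partial>C 0 n ?u)"
      by (intro nn_integral_cong) (simp add: space_C[OF u] nn_integral_eP[OF _ f])
    finally show ?thesis .
  qed
  have C_marginal: "(\<integral>\<^sup>+\<omega>. f (\<omega> n) \<partial>C 0 (Suc n) ?u) = (\<integral>\<^sup>+x. f x \<partial>marginal G \<mu> \<nu> \<rho> n)"
    for f :: "_ \<Rightarrow> ennreal"
  proof (induction n arbitrary: f)
    case 0
    show ?case
      unfolding C_Suc by (simp add: nn_integral_return[OF u])
  next
    case (Suc n)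
    \<comment> \<open>The kernel at time n + 1 reads only coordinate n of the history, so
      integrating f against it gives a function of that coordinate, to which the induction
      hypothesis applies.\<close>
    show ?case
      unfolding C_Suc[where n = "Suc n"] kernel.simps marginal.simps
      by (subst Suc[of "\<lambda>z. \<integral>\<^sup>+x. f x \<partial>(case z of (s, a, b) \<Rightarrow> play_from \<mu> \<nu> (trans G s a b))"])
        (simp add: nn_integral_bind_pmf)
  qed
  \<comment> \<open>\<open>up_to\<close> is the least n such that no index from n on lies in the
    set, so \<open>CI\<close> on these indices comes from \<open>C 0 (Suc n)\<close>.\<close>
  have up_to_n: "up_to {0..<Suc n} = Suc n"
    unfolding up_to_def by (rule Least_equality) (force simp: not_less_eq_eq[symmetric])+
  have comp [measurable]: "(\<lambda>\<omega>. \<omega> n) \<in> PiM {0..<Suc n} ?S \<rightarrow>\<^sub>M count_space UNIV"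
    by (rule measurable_component_singleton) simp
  have [measurable]: "(\<lambda>\<omega>. restrict \<omega> {0..<Suc n}) \<in> C 0 (Suc n) ?u \<rightarrow>\<^sub>M PiM {0..<Suc n} ?S"
    by (subst measurable_cong_sets[OF sets_C[OF u] refl]) (rule measurable_restrict_subset, simp)
  have C_comp [measurable]: "(\<lambda>\<omega>. \<omega> n) \<in> C 0 (Suc n) ?u \<rightarrow>\<^sub>M count_space UNIV"
    by (subst measurable_cong_sets[OF sets_C[OF u] refl]) (use comp in simp)
  have [measurable]: "(\<lambda>\<omega>. restrict \<omega> {0..<Suc n}) \<in> PF.lim \<rightarrow>\<^sub>M PiM {0..<Suc n} ?S"
    by (subst measurable_cong_sets[OF PF.sets_lim refl]) (rule measurable_restrict_subset, simp)
  have "distr (process G \<mu> \<nu> \<rho>) (count_space UNIV) (\<lambda>\<omega>. \<omega> n)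
      = distr (distr PF.lim (PiM {0..<Suc n} ?S) (\<lambda>\<omega>. restrict \<omega> {0..<Suc n})) (count_space UNIV) (\<lambda>\<omega>. \<omega> n)"
    by (subst distr_distr) (auto simp: process_def comp_def)
  also have "\<dots> = distr (C 0 (Suc n) ?u) (count_space UNIV) (\<lambda>\<omega>. \<omega> n)"
    by (subst distr_lim, simp, unfold CI_def up_to_n, subst distr_distr)
      (auto simp: comp_def simp del: C.simps)
  also have "\<dots> = measure_pmf (marginal G \<mu> \<nu> \<rho> n)"
  proof (rule measure_eqI)
    fix A :: "('s \<times> 'a \<times> 'b) set"
    have "emeasure (distr (C 0 (Suc n) ?u) (count_space UNIV) (\<lambda>\<omega>. \<omega> n)) A
        = (\<integral>\<^sup>+x. indicator A x \<partial>distr (C 0 (Suc n) ?u) (count_space UNIV) (\<lambda>\<omega>. \<omega> n))"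
      by simp
    also have "\<dots> = (\<integral>\<^sup>+\<omega>. indicator A (\<omega> n) \<partial>C 0 (Suc n) ?u)"
      by (rule nn_integral_distr[OF C_comp]) simp
    also have "\<dots> = emeasure (marginal G \<mu> \<nu> \<rho> n) A"
      unfolding C_marginal by simp
    finally show "emeasure (distr (C 0 (Suc n) ?u) (count_space UNIV) (\<lambda>\<omega>. \<omega> n)) A
        = emeasure (marginal G \<mu> \<nu> \<rho> n) A" .
  qed simp
  finally show ?thesis .
qed

text \<open>The geometric series with terms \<open>d ^ t * B\<close> dominates, so sum and integral
  commute. Values use this with the reward, occupancies with an indicator.\<close>

lemma integral_process_discounted:
  fixes G :: "('s, 'a, 'b) game" and f :: "'s \<times> 'a \<times> 'b \<Rightarrow> real"
  assumes bound: "\<And>x. \<bar>f x\<bar> \<le> B" and d: "0 \<le> d" "d < 1"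
  shows "(\<integral>\<omega>. (\<Sum>t. d ^ t * f (\<omega> t)) \<partial>process G \<mu> \<nu> \<rho>)
      = (\<Sum>t. d ^ t * (\<integral>x. f x \<partial>marginal G \<mu> \<nu> \<rho> t))"
proof -
  interpret prob_space "process G \<mu> \<nu> \<rho>"
    by (rule prob_space_process)
  have f: "(\<lambda>\<omega>. f (\<omega> t)) \<in> borel_measurable (process G \<mu> \<nu> \<rho>)" for t
    by (rule measurable_compose[OF measurable_process_component]) simp
  have term_bound: "norm (d ^ t * f x) \<le> d ^ t * B" for t x
    using bound[of x] d by (simp add: abs_mult mult_left_mono)
  have summable_bound: "summable (\<lambda>t. d ^ t * B)"
    using d by (intro summable_mult2 summable_geometric) simp
  have integrable: "integrable (process G \<mu> \<nu> \<rho>) (\<lambda>\<omega>. d ^ t * f (\<omega> t))" for t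
    by (rule integrable_const_bound[where B = "d ^ t * B"]) (use f term_bound in auto)
  have "(\<integral>\<omega>. (\<Sum>t. d ^ t * f (\<omega> t)) \<partial>process G \<mu> \<nu> \<rho>)
      = (\<Sum>t. \<integral>\<omega>. d ^ t * f (\<omega> t) \<partial>process G \<mu> \<nu> \<rho>)"
  proof (rule integral_suminf[OF integrable])
    show "AE \<omega> in process G \<mu> \<nu> \<rho>. summable (\<lambda>t. norm (d ^ t * f (\<omega> t)))"
      by (intro AE_I2 summable_comparison_test'[OF summable_bound, of 0]) (use term_bound in auto)
    have "(\<integral>\<omega>. norm (d ^ t * f (\<omega> t)) \<partial>process G \<mu> \<nu> \<rho>) \<le> d ^ t * B" for t :: nat
      by (rule integral_le_const[OF integrable_norm[OF integrable]]) (use term_bound in simp)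
    then show "summable (\<lambda>t. \<integral>\<omega>. norm (d ^ t * f (\<omega> t)) \<partial>process G \<mu> \<nu> \<rho>)"
      by (intro summable_comparison_test'[OF summable_bound, of 0]) simp
  qed
  also have "\<dots> = (\<Sum>t. d ^ t * (\<integral>x. f x \<partial>marginal G \<mu> \<nu> \<rho> t))"
    by (simp add: distr_process_component[symmetric] integral_distr)
  finally show ?thesis .
qed

section \<open>The hard games\<close>

definition score :: "nat \<Rightarrow> (nat \<Rightarrow> nat) \<Rightarrow> nat \<Rightarrow> nat \<Rightarrow> real" where
  "score M c s a = of_bool (0 < s \<and> s < M \<and> a = c s)"

text \<open>Actions 0 to 3 are the candidates for the hidden one. Action 4 is reserved for the exit
  from state 0, so no admissible \<open>c\<close> makes the expert leave.\<close>

definition hard_game :: "real \<Rightarrow> nat \<Rightarrow> (nat \<Rightarrow> nat) \<Rightarrow> (nat, nat, nat) game" where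
  "hard_game \<gamma> M c =
     \<lparr>states = {..M}, actions1 = {..4}, actions2 = {..4}, disc = \<gamma>, init = pmf_of_set {..<M},
      trans = (\<lambda>s a b. return_pmf (if s = 0 \<and> a = 4 then M else s)),
      reward = (\<lambda>s a b. score M c s a - score M c s b)\<rparr>"

text \<open>One function serves both players, since the reward is antisymmetric in the two actions.
  It is cut off outside the states because \<open>policies\<close> contains extensional functions
  only.\<close>

definition expert :: "nat \<Rightarrow> (nat \<Rightarrow> nat) \<Rightarrow> nat \<Rightarrow> nat pmf" where
  "expert M c = (\<lambda>s\<in>{..M}. return_pmf (c s))"

lemma hard_game_sel [simp]:
  "states (hard_game \<gamma> M c) = {..M}"
  "actions1 (hard_game \<gamma> M c) = {..4}"
  "actions2 (hard_game \<gamma> M c) = {..4}"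
  "disc (hard_game \<gamma> M c) = \<gamma>"
  "init (hard_game \<gamma> M c) = pmf_of_set {..<M}"
  "trans (hard_game \<gamma> M c) s a b = return_pmf (if s = 0 \<and> a = 4 then M else s)"
  "reward (hard_game \<gamma> M c) s a b = score M c s a - score M c s b"
  by (simp_all add: hard_game_def)

text \<open>Neither the spaces nor the dynamics reveal \<open>c\<close>; this lets one argument
  cover learners with and without knowledge of the transition kernel.\<close>

lemma truncate_hard_game:
  "env.truncate (hard_game \<gamma> M c) = env.truncate (hard_game \<gamma> M c')"
  "dyn.truncate (hard_game \<gamma> M c) = dyn.truncate (hard_game \<gamma> M c')"
  by (simp_all add: hard_game_def env.truncate_def dyn.truncate_def)

lemma markov_game_hard_game:
  assumes "0 < M" "0 \<le> \<gamma>" "\<gamma> < 1"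
  shows "markov_game (hard_game \<gamma> M c)"
  using assms by (auto simp: markov_game_def score_def lessThan_empty_iff)

lemma expert_in_policies:
  assumes "c \<in> {..M} \<rightarrow> {..<4}"
  shows "expert M c \<in> policies {..M} {..4}"
  using assms by (auto simp: policies_def expert_def Pi_iff less_imp_le)

section \<open>Values and best responses in the hard games\<close>

lemma play_from_return_pmf:
  "play_from \<mu> \<nu> (return_pmf s) = map_pmf (Pair s) (pair_pmf (\<mu> s) (\<nu> s))"
  by (simp add: play_from_def pair_pmf_def map_pmf_def bind_assoc_pmf bind_return_pmf)

lemma marginal_absorbing:
  assumes "0 < s"
  shows "marginal (hard_game \<gamma> M c) \<mu> \<nu> (return_pmf s) t = play_from \<mu> \<nu> (return_pmf s)"
proof (induction t)
  case (Suc t)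
  have "marginal (hard_game \<gamma> M c) \<mu> \<nu> (return_pmf s) (Suc t)
      = bind_pmf (play_from \<mu> \<nu> (return_pmf s)) (\<lambda>_. play_from \<mu> \<nu> (return_pmf s))"
    unfolding marginal.simps Suc
    by (rule bind_pmf_cong) (use assms in \<open>auto simp: play_from_def\<close>)
  then show ?case
    by simp
qed simp

text \<open>How the mass is split between 0 and the sink depends on player 1, but both states pay
  nothing, which gives state 0 the value 0.\<close>

lemma set_pmf_marginal_neutral:
  "set_pmf (marginal (hard_game \<gamma> M c) \<mu> \<nu> (return_pmf 0) t) \<subseteq> {0, M} \<times> UNIV"
  by (induction t) (fastforce simp: play_from_def split: if_splits)+

text \<open>The reward is a difference of functions of one action each, so only the two factors of
  the product law enter.\<close>

lemma integral_reward_play_from: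
  assumes "0 < s" "s < M"
  shows "(\<integral>x. (case x of (s', a, b) \<Rightarrow> reward (hard_game \<gamma> M c) s' a b)
      \<partial>play_from \<mu> \<nu> (return_pmf s)) = pmf (\<mu> s) (c s) - pmf (\<nu> s) (c s)"
proof -
  let ?p = "pair_pmf (\<mu> s) (\<nu> s)"
  have "(\<integral>x. (case x of (s', a, b) \<Rightarrow> reward (hard_game \<gamma> M c) s' a b) \<partial>play_from \<mu> \<nu> (return_pmf s))
      = (\<integral>x. indicator {c s} (fst x) - indicator {c s} (snd x) \<partial>?p)"
    using assms unfolding play_from_return_pmf integral_map_pmf
    by (intro Bochner_Integration.integral_cong) (auto simp: score_def indicator_def)
  also have "\<dots> = (\<integral>x. indicator {c s} (fst x) \<partial>?p) - (\<integral>x. indicator {c s} (snd x) \<partial>?p)"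
    by (intro Bochner_Integration.integral_diff measure_pmf.integrable_const_bound[where B = 1]) auto
  also have "\<dots> = (\<integral>a. indicator {c s} a \<partial>map_pmf fst ?p) - (\<integral>b. indicator {c s} b \<partial>map_pmf snd ?p)"
    unfolding integral_map_pmf ..
  also have "\<dots> = pmf (\<mu> s) (c s) - pmf (\<nu> s) (c s)"
    by (simp add: map_fst_pair_pmf map_snd_pair_pmf measure_pmf_single)
  finally show ?thesis .
qed

lemma val_hard_game:
  assumes "0 \<le> \<gamma>" "\<gamma> < 1"
  shows "s < M \<Longrightarrow> val (hard_game \<gamma> M c) \<mu> \<nu> s =
    (if 0 < s then (pmf (\<mu> s) (c s) - pmf (\<nu> s) (c s)) / (1 - \<gamma>) else 0)"
proof -
  assume "s < M"
  let ?r = "\<lambda>x. case x of (s', a, b) \<Rightarrow> reward (hard_game \<gamma> M c) s' a b"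
  let ?m = "marginal (hard_game \<gamma> M c) \<mu> \<nu> (return_pmf s)"
  have "\<bar>?r x\<bar> \<le> 1" for x
    by (auto simp: score_def split: prod.split)
  then have val: "val (hard_game \<gamma> M c) \<mu> \<nu> s = (\<Sum>t. \<gamma> ^ t * (\<integral>x. ?r x \<partial>?m t))"
    unfolding val_def hard_game_sel(4) using assms
    by (intro integral_process_discounted[where f = ?r and B = 1])
  show ?thesis
  proof (cases "0 < s")
    case True
    then have "val (hard_game \<gamma> M c) \<mu> \<nu> s = (\<Sum>t. \<gamma> ^ t * (pmf (\<mu> s) (c s) - pmf (\<nu> s) (c s)))"
      by (simp only: val marginal_absorbing integral_reward_play_from \<open>s < M\<close>)
    also have "\<dots> = (pmf (\<mu> s) (c s) - pmf (\<nu> s) (c s)) / (1 - \<gamma>)"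
      using assms by (simp add: suminf_mult2[symmetric] summable_geometric suminf_geometric)
    finally show ?thesis
      using True by simp
  next
    case False
    have zero: "(\<integral>x. ?r x \<partial>?m t) = 0" for t
      using False set_pmf_marginal_neutral[of \<gamma> M c \<mu> \<nu> t]
      by (intro integral_eq_zero_AE AE_pmfI) (force simp: score_def split: prod.split)
    then show ?thesis
      using False unfolding val zero by simp
  qed
qed

text \<open>Up to the factor \<open>1 / (real M * (1 - \<gamma>))\<close> this is a player's
  contribution to the value averaged over the initial law, with a plus sign for player 1 and a minus
  sign for player 2.\<close>

definition agreement :: "nat \<Rightarrow> (nat \<Rightarrow> nat) \<Rightarrow> (nat \<Rightarrow> nat pmf) \<Rightarrow> real" where
  "agreement M c \<mu> = (\<Sum>s\<in>{0<..<M}. pmf (\<mu> s) (c s))"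

lemma agreement_expert: "agreement M c (expert M c) = real (M - 1)"
  by (simp add: agreement_def expert_def)

lemma agreement_le: "agreement M c \<mu> \<le> real (M - 1)"
  using sum_mono[of "{0<..<M}" "\<lambda>s. pmf (\<mu> s) (c s)" "\<lambda>_. 1"] by (simp add: agreement_def pmf_le_1)

lemma init_avg_hard_game:
  assumes "0 < M"
  shows "init_avg (hard_game \<gamma> M c) f = (\<Sum>s<M. f s) / real M"
proof -
  have "init_avg (hard_game \<gamma> M c) f = (\<Sum>s\<le>M. pmf (pmf_of_set {..<M}) s * f s)"
    by (simp add: init_avg_def)
  also have "\<dots> = (\<Sum>s<M. f s / real M)"
    using assms by (intro sum.mono_neutral_cong_right) (auto simp: lessThan_empty_iff)
  finally show ?thesis
    by (simp add: sum_divide_distrib)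
qed

lemma init_avg_val_hard_game:
  assumes "0 < M" "0 \<le> \<gamma>" "\<gamma> < 1"
  shows "init_avg (hard_game \<gamma> M c) (val (hard_game \<gamma> M c) \<mu> \<nu>)
    = (agreement M c \<mu> - agreement M c \<nu>) / (real M * (1 - \<gamma>))"
proof -
  have "(\<Sum>s<M. val (hard_game \<gamma> M c) \<mu> \<nu> s)
      = (\<Sum>s\<in>{0<..<M}. (pmf (\<mu> s) (c s) - pmf (\<nu> s) (c s)) / (1 - \<gamma>))"
    using assms by (intro sum.mono_neutral_cong_right) (auto simp: val_hard_game)
  then show ?thesis
    using assms by (simp add: init_avg_hard_game agreement_def sum_subtractf sum_divide_distrib[symmetric])
qed

text \<open>The averaged value is a difference of agreements, so maximal agreement is optimal in
  either role against every opponent. Behaviour in state 0 stays free.\<close>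

lemma best_responses_hard_game:
  assumes "0 < M" "0 \<le> \<gamma>" "\<gamma> < 1" "\<mu> \<in> policies {..M} {..4}" "agreement M c \<mu> = real (M - 1)"
  shows "\<mu> \<in> br1 (hard_game \<gamma> M c) \<nu>" "\<mu> \<in> br2 (hard_game \<gamma> M c) \<nu>"
proof -
  have "agreement M c \<mu>' \<le> agreement M c \<mu>" for \<mu>'
    using agreement_le assms(5) by simp
  then show "\<mu> \<in> br1 (hard_game \<gamma> M c) \<nu>" "\<mu> \<in> br2 (hard_game \<gamma> M c) \<nu>"
    using assms(1-4)
    by (auto simp: br1_def br2_def init_avg_val_hard_game intro!: divide_right_mono diff_mono)
qed

lemma nash_expert:
  assumes "0 < M" "0 \<le> \<gamma>" "\<gamma> < 1" "c \<in> {..M} \<rightarrow> {..<4}"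
  shows "nash (hard_game \<gamma> M c) (expert M c) (expert M c)"
  using assms by (simp add: nash_def best_responses_hard_game expert_in_policies agreement_expert)

section \<open>Occupancy measures and infinite concentrability\<close>

lemma occ_eq:
  assumes "0 \<le> disc G" "disc G < 1"
  shows "occ G \<mu> \<nu> s
    = (1 - disc G) * (\<Sum>t. disc G ^ t * measure (marginal G \<mu> \<nu> (init G) t) ({s} \<times> UNIV))"
proof -
  have "(\<integral>\<omega>. (\<Sum>t. disc G ^ t * indicator {s} (fst (\<omega> t))) \<partial>process G \<mu> \<nu> (init G))
      = (\<Sum>t. disc G ^ t * (\<integral>x. indicator {s} (fst x) \<partial>marginal G \<mu> \<nu> (init G) t))"
    using assms by (intro integral_process_discounted[where B = 1]) (auto simp: indicator_def)
  moreover have "(\<integral>x. indicator {s} (fst x) \<partial>marginal G \<mu> \<nu> (init G) t)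
      = measure (marginal G \<mu> \<nu> (init G) t) ({s} \<times> UNIV)" for t
  proof -
    have eq: "(\<lambda>x. indicator {s} (fst x) :: real) = indicator ({s} \<times> UNIV)"
      by (auto simp: indicator_def fun_eq_iff)
    show ?thesis
      unfolding eq by simp
  qed
  ultimately show ?thesis
    by (simp add: occ_def)
qed

lemma play_from_expert:
  assumes "set_pmf \<rho> \<subseteq> {..<M}"
  shows "play_from (expert M c) (expert M c) \<rho> = map_pmf (\<lambda>s. (s, c s, c s)) \<rho>"
  unfolding play_from_def map_pmf_def using assms
  by (intro bind_pmf_cong) (auto simp: expert_def bind_return_pmf)

text \<open>The expert's actions lie below 4, so the exit is never taken and the state keeps its
  initial law for all time.\<close>

lemma marginal_expert:
  assumes "c \<in> {..M} \<rightarrow> {..<4}" "set_pmf \<rho> \<subseteq> {..<M}"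
  shows "marginal (hard_game \<gamma> M c) (expert M c) (expert M c) \<rho> t = map_pmf (\<lambda>s. (s, c s, c s)) \<rho>"
proof (induction t)
  case 0
  show ?case
    by (simp add: play_from_expert assms(2))
next
  case (Suc t)
  have "marginal (hard_game \<gamma> M c) (expert M c) (expert M c) \<rho> (Suc t)
      = bind_pmf \<rho> (\<lambda>s. return_pmf (s, c s, c s))"
    unfolding marginal.simps Suc bind_map_pmf
  proof (rule bind_pmf_cong[OF refl])
    fix s assume "s \<in> set_pmf \<rho>"
    then have "s < M"
      using assms(2) by auto
    moreover from this have "c s < 4"
      using assms(1) by (simp add: Pi_iff)
    ultimately show "(case (s, c s, c s) of (s, a, b) \<Rightarrow>
        play_from (expert M c) (expert M c) (trans (hard_game \<gamma> M c) s a b)) = return_pmf (s, c s, c s)"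
      by (simp add: play_from_expert)
  qed
  then show ?case
    by (simp add: map_pmf_def)
qed

lemma occ_expert_sink:
  assumes "0 < M" "0 \<le> \<gamma>" "\<gamma> < 1" "c \<in> {..M} \<rightarrow> {..<4}"
  shows "occ (hard_game \<gamma> M c) (expert M c) (expert M c) M = 0"
proof -
  have "measure (marginal (hard_game \<gamma> M c) (expert M c) (expert M c) (pmf_of_set {..<M}) t)
      ({M} \<times> UNIV) = 0" for t
    using assms(1,4) by (auto simp: marginal_expert measure_pmf_zero_iff lessThan_empty_iff)
  then show ?thesis
    using assms(2,3) by (simp add: occ_eq)
qed

lemma occ_deviation_sink:
  assumes "0 < M" "0 < \<gamma>" "\<gamma> < 1"
  shows "0 < occ (hard_game \<gamma> M c) ((expert M c)(0 := return_pmf 4)) (expert M c) M"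
proof -
  let ?\<mu> = "(expert M c)(0 := return_pmf 4)"
  let ?m = "marginal (hard_game \<gamma> M c) ?\<mu> (expert M c) (pmf_of_set {..<M})"
  \<comment> \<open>A play that starts in 0, which has initial mass 1 / M, exits at once and is in
    the sink at time 1.\<close>
  have "(0, 4, c 0) \<in> set_pmf (?m 0)"
    using assms by (force simp: play_from_def expert_def lessThan_empty_iff)
  then have "(M, c M, c M) \<in> set_pmf (?m 1)"
    using assms(1) by (force simp: play_from_def expert_def)
  then have "0 < measure (?m 1) ({M} \<times> UNIV)"
    by (rule measure_pmf_posI) auto
  moreover have "summable (\<lambda>t. \<gamma> ^ t * measure (?m t) ({M} \<times> UNIV))"
    using assms by (intro summable_comparison_test'[OF summable_geometric[of \<gamma>], of 0])
      (auto simp: abs_mult mult_left_le)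
  ultimately have "0 < (\<Sum>t. \<gamma> ^ t * measure (?m t) ({M} \<times> UNIV))"
    \<comment> \<open>The term with t = 1 carries the weight \<gamma>, so strict positivity rests on
      \<open>0 < \<gamma>\<close>.\<close>
    using assms by (intro suminf_pos2[of _ 1]) auto
  then show ?thesis
    using assms by (simp add: occ_eq)
qed

lemma concentrability_expert:
  assumes "0 < M" "0 < \<gamma>" "\<gamma> < 1" "c \<in> {..M} \<rightarrow> {..<4}"
  shows "concentrability (hard_game \<gamma> M c) (expert M c) (expert M c) = \<infinity>"
proof -
  let ?G = "hard_game \<gamma> M c" and ?\<mu> = "(expert M c)(0 := return_pmf 4)"
  \<comment> \<open>The deviation changes the policy at 0 only, a state over which
    \<open>agreement\<close> does not sum.\<close>
  have "agreement M c ?\<mu> = agreement M c (expert M c)"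
    by (simp add: agreement_def)
  moreover have "?\<mu> \<in> policies {..M} {..4}"
    using expert_in_policies[OF assms(4)] by (auto simp: policies_def PiE_iff extensional_def)
  ultimately have dev: "?\<mu> \<in> br1 ?G (expert M c)"
    using assms by (intro best_responses_hard_game) (auto simp: agreement_expert)
  have "\<infinity> = ennreal (occ ?G ?\<mu> (expert M c) M) / ennreal (occ ?G (expert M c) (expert M c) M)"
    using assms occ_deviation_sink[OF assms(1-3)]
    by (simp add: occ_expert_sink ennreal_eq_0_iff not_le)
  also have "\<dots> \<le> ratio_norm ?G (occ ?G ?\<mu> (expert M c)) (occ ?G (expert M c) (expert M c))"
    unfolding ratio_norm_def by (rule SUP_upper) simp
  also have "\<dots> \<le> concentrability ?G (expert M c) (expert M c)"
    unfolding concentrability_def by (intro max.coboundedI1 SUP_upper dev)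
  finally show ?thesis
    by (simp add: top_unique infinity_ennreal_def)
qed

section \<open>The dataset as a function of the hidden actions\<close>

text \<open>All randomness sits in the list of pairs of a failure count and an initial state;
  \<open>c\<close> enters only through this deterministic map. A trajectory has length
  \<open>Suc h\<close> because H counts the success as well.\<close>

definition observe :: "(nat \<Rightarrow> nat) \<Rightarrow> (nat \<times> nat) list \<Rightarrow> (nat \<times> nat \<times> nat) list list" where
  "observe c = map (\<lambda>(h, s). replicate (Suc h) (s, c s, c s))"

lemma length_observe [simp]: "length (observe c z) = length z"
  by (simp add: observe_def)

text \<open>The data carry no information about the hidden action of a state that does not occur in
  them.\<close>

lemma observe_fun_upd:
  assumes "s \<notin> snd ` set z"
  shows "observe (c(s := k)) z = observe c z"
  using assms by (force simp: observe_def)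

lemma replicate_pmf_map_pmf: "replicate_pmf n (map_pmf f p) = map_pmf (map f) (replicate_pmf n p)"
  by (induction n) (simp_all add: map_bind_pmf bind_map_pmf)

lemma rollout_expert:
  assumes "c \<in> {..M} \<rightarrow> {..<4}" "set_pmf \<rho> \<subseteq> {..<M}"
  shows "rollout (hard_game \<gamma> M c) (expert M c) (expert M c) h \<rho>
    = map_pmf (\<lambda>s. replicate h (s, c s, c s)) \<rho>"
  using assms(2)
\<comment> \<open>The initial law is generalized because after one step the rollout continues from
  the point mass at the current state.\<close>
proof (induction h arbitrary: \<rho>)
  case (Suc h)
  let ?G = "hard_game \<gamma> M c"
  have "rollout ?G (expert M c) (expert M c) (Suc h) \<rho>
      = bind_pmf \<rho> (\<lambda>s. return_pmf (replicate (Suc h) (s, c s, c s)))"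
    unfolding rollout.simps play_from_expert[OF Suc.prems] bind_map_pmf
  proof (rule bind_pmf_cong[OF refl])
    fix s assume "s \<in> set_pmf \<rho>"
    then have "s < M"
      using Suc.prems by auto
    moreover from this have "c s < 4"
      using assms(1) by (simp add: Pi_iff)
    ultimately show "(case (s, c s, c s) of (s, a, b) \<Rightarrow>
          map_pmf ((#) (s, a, b)) (rollout ?G (expert M c) (expert M c) h (trans ?G s a b)))
        = return_pmf (replicate (Suc h) (s, c s, c s))"
      by (simp add: Suc.IH)
  qed
  then show ?case
    by (simp add: map_pmf_def)
qed simp

definition samples :: "real \<Rightarrow> nat \<Rightarrow> nat \<Rightarrow> (nat \<times> nat) list pmf" where
  "samples \<gamma> M N = replicate_pmf N (pair_pmf (geometric_pmf (1 - \<gamma>)) (pmf_of_set {..<M}))"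

text \<open>This couples the datasets of all hard games: \<open>samples\<close> does not depend on
  \<open>c\<close>, so \<open>c\<close> can be averaged out for a fixed sample.\<close>

lemma dataset_expert:
  assumes "0 < M" "c \<in> {..M} \<rightarrow> {..<4}"
  shows "dataset_pmf (hard_game \<gamma> M c) (expert M c) (expert M c) N
    = map_pmf (observe c) (samples \<gamma> M N)"
proof -
  have "trajectory_pmf (hard_game \<gamma> M c) (expert M c) (expert M c)
      = map_pmf (\<lambda>(h, s). replicate (Suc h) (s, c s, c s))
          (pair_pmf (geometric_pmf (1 - \<gamma>)) (pmf_of_set {..<M}))"
    using assms
    by (simp add: trajectory_pmf_def bind_map_pmf rollout_expert lessThan_empty_iff pair_pmf_def
        map_bind_pmf map_pmf_def bind_assoc_pmf bind_return_pmf del: replicate_Suc)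
  then show ?thesis
    by (simp add: dataset_pmf_def samples_def replicate_pmf_map_pmf observe_def)
qed

text \<open>The expert never moves, so each trajectory shows one state only.\<close>

lemma card_seen_le:
  assumes "z \<in> set_pmf (samples \<gamma> M N)"
  shows "length z = N" "card (snd ` set z) \<le> N"
proof -
  show "length z = N"
    using assms by (simp add: samples_def set_replicate_pmf)
  then show "card (snd ` set z) \<le> N"
    using card_length[of "map snd z"] by simp
qed

section \<open>Averaging over the hidden actions\<close>

lemma measurable_pmf_policy_space:
  assumes "s \<in> S" "a \<in> A"
  shows "(\<lambda>\<mu>. pmf (\<mu> s) a) \<in> borel_measurable (policy_space S A)"
proof -
  let ?f = "\<lambda>\<mu>. \<lambda>s\<in>S. \<lambda>a\<in>A. pmf (\<mu> s) a"
  have "?f \<in> policy_space S A \<rightarrow>\<^sub>M PiM S (\<lambda>_. PiM A (\<lambda>_. borel :: real measure))"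
    unfolding policy_space_def by (rule measurable_vimage_algebra1) (auto simp: space_PiM)
  from measurable_compose[OF this measurable_component_singleton[OF assms(1)]]
  have "(\<lambda>\<mu>. ?f \<mu> s a) \<in> borel_measurable (policy_space S A)"
    by (rule measurable_compose[OF _ measurable_component_singleton[OF assms(2)]])
  then show ?thesis
    using assms by simp
qed

text \<open>Isolates one coordinate, so that the hidden action of an unseen state can be averaged
  with all others held fixed.\<close>

lemma sum_PiE_split:
  assumes "finite I" "\<And>i. i \<in> I \<Longrightarrow> finite (A i)" "x \<in> I"
  shows "(\<Sum>c\<in>PiE I A. f c) = (\<Sum>g\<in>PiE (I - {x}) A. \<Sum>k\<in>A x. f (g(x := k)))"
proof -
  have "PiE I A = (\<lambda>(k, g). g(x := k)) ` (A x \<times> PiE (I - {x}) A)"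
    using PiE_insert_eq[of x "I - {x}" A] assms(3) by (simp add: insert_absorb)
  moreover have "inj_on (\<lambda>(k, g). g(x := k)) (A x \<times> PiE (I - {x}) A)"
    by (rule inj_combinator) simp
  ultimately have "(\<Sum>c\<in>PiE I A. f c) = (\<Sum>y\<in>A x \<times> PiE (I - {x}) A. (f \<circ> (\<lambda>(k, g). g(x := k))) y)"
    by (simp only: sum.reindex)
  also have "\<dots> = (\<Sum>(k, g)\<in>A x \<times> PiE (I - {x}) A. f (g(x := k)))"
    by (simp add: comp_def case_prod_beta)
  also have "\<dots> = (\<Sum>g\<in>PiE (I - {x}) A. \<Sum>k\<in>A x. f (g(x := k)))"
    by (subst sum.cartesian_product[symmetric]) (rule sum.swap)
  finally show ?thesis .
qed

text \<open>The joint shortfall of the two players in state s if k is the hidden action, up to the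
  factor \<open>1 / (1 - \<gamma>)\<close>.\<close>

definition miss :: "((nat \<Rightarrow> nat pmf) \<times> (nat \<Rightarrow> nat pmf)) measure \<Rightarrow> nat \<Rightarrow> nat \<Rightarrow> ennreal" where
  "miss Q s k = (\<integral>\<^sup>+(\<mu>, \<nu>). ennreal (2 - pmf (\<mu> s) k - pmf (\<nu> s) k) \<partial>Q)"

lemma random_outputs_hard_gameD:
  assumes "Q \<in> random_outputs (hard_game \<gamma> M c)"
  shows "prob_space Q" "space Q = policies {..M} {..4} \<times> policies {..M} {..4}"
    and "s \<le> M \<Longrightarrow> k \<le> 4 \<Longrightarrow>
      (\<lambda>(\<mu>, \<nu>). ennreal (2 - pmf (\<mu> s) k - pmf (\<nu> s) k)) \<in> borel_measurable Q"
proof -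
  let ?P = "policy_space {..M} {..4}"
  have sets: "sets Q = sets (?P \<Otimes>\<^sub>M ?P)"
    using assms by (simp add: random_outputs_def space_prob_algebra)
  show "prob_space Q"
    using assms by (simp add: random_outputs_def space_prob_algebra)
  show "space Q = policies {..M} {..4} \<times> policies {..M} {..4}"
    using sets_eq_imp_space_eq[OF sets] by (simp add: space_pair_measure policy_space_def)
  assume "s \<le> M" "k \<le> 4"
  then have [measurable]: "(\<lambda>\<mu>. pmf (\<mu> s) k) \<in> borel_measurable ?P"
    by (intro measurable_pmf_policy_space) auto
  show "(\<lambda>(\<mu>, \<nu>). ennreal (2 - pmf (\<mu> s) k - pmf (\<nu> s) k)) \<in> borel_measurable Q"
    unfolding measurable_cong_sets[OF sets refl] by measurable
qed

lemma sum_miss_ge: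
  assumes "Q \<in> random_outputs (hard_game \<gamma> M c)" "s \<le> M"
  shows "6 \<le> (\<Sum>k<4. miss Q s k)"
proof -
  interpret prob_space Q
    by (rule random_outputs_hard_gameD[OF assms(1)])
  have le: "(\<Sum>k<4. pmf p k) \<le> 1" for p :: "nat pmf"
    by (simp add: measure_pmf.prob_le_1 flip: measure_measure_pmf_finite)
  \<comment> \<open>6 = 4 * 2 - 1 - 1, as each of the two laws has total mass at most 1 on the four
    candidates.\<close>
  have "6 \<le> (\<Sum>k<4::nat. ennreal (2 - pmf p k - pmf q k))" for p q :: "nat pmf"
  proof -
    have "2 - pmf p k - pmf q k \<ge> 0" for k
      using pmf_le_1[of p k] pmf_le_1[of q k] by simp
    then have "(\<Sum>k<4::nat. ennreal (2 - pmf p k - pmf q k)) = ennreal (\<Sum>k<4::nat. 2 - pmf p k - pmf q k)"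
      by (intro sum_ennreal) auto
    moreover have "6 \<le> (\<Sum>k<4::nat. 2 - pmf p k - pmf q k)"
      using le[of p] le[of q] by (simp add: sum_subtractf)
    ultimately show ?thesis
      by (metis ennreal_leI ennreal_numeral zero_le_numeral)
  qed
  then have "(\<integral>\<^sup>+x. 6 \<partial>Q) \<le> (\<integral>\<^sup>+(\<mu>, \<nu>). (\<Sum>k<4::nat. ennreal (2 - pmf (\<mu> s) k - pmf (\<nu> s) k)) \<partial>Q)"
    by (intro nn_integral_mono) (simp add: case_prod_beta)
  also have "\<dots> = (\<Sum>k<4. miss Q s k)"
    using random_outputs_hard_gameD(3)[OF assms] unfolding miss_def case_prod_beta
    by (intro nn_integral_sum) auto
  finally show ?thesis
    by (simp add: emeasure_space_1)
qed

text \<open>For an unseen s the output is the same for all four values of \<open>c s\<close>, so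
  \<open>sum_miss_ge\<close> applies to each group of four; \<open>4 ^ M\<close> counts the choices
  in the other M states.\<close>

lemma sum_miss_unseen:
  assumes "\<And>c. alg (observe c z) \<in> random_outputs (hard_game \<gamma> M c)"
    and "s \<le> M" "s \<notin> snd ` set z"
  shows "6 * 4 ^ M \<le> (\<Sum>c\<in>{..M} \<rightarrow>\<^sub>E {..<4}. miss (alg (observe c z)) s (c s))"
proof -
  have "6 * 4 ^ M = (\<Sum>g\<in>({..M} - {s}) \<rightarrow>\<^sub>E {..<4::nat}. 6 :: ennreal)"
    using assms(2) by (simp add: card_PiE mult.commute)
  \<comment> \<open>\<open>g\<close> takes the default value \<open>undefined\<close> at s, which is
    harmless because s does not occur in \<open>z\<close>.\<close>
  also have "\<dots> \<le> (\<Sum>g\<in>({..M} - {s}) \<rightarrow>\<^sub>E {..<4}. \<Sum>k<4. miss (alg (observe g z)) s k)"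
    by (intro sum_mono sum_miss_ge[OF assms(1,2)])
  also have "\<dots> = (\<Sum>c\<in>{..M} \<rightarrow>\<^sub>E {..<4}. miss (alg (observe c z)) s (c s))"
    using assms(2,3) by (subst sum_PiE_split[of _ _ s]) (auto simp: observe_fun_upd)
  finally show ?thesis .
qed

lemma sum_miss_samples:
  assumes "\<And>c D. length D = N \<Longrightarrow> alg D \<in> random_outputs (hard_game \<gamma> M c)"
    and "M = 3 * N + 3" "z \<in> set_pmf (samples \<gamma> M N)"
  shows "of_nat (card ({..M} \<rightarrow>\<^sub>E {..<4::nat})) * of_nat M
    \<le> (\<Sum>c\<in>{..M} \<rightarrow>\<^sub>E {..<4}. \<Sum>s\<in>{0<..<M}. miss (alg (observe c z)) s (c s))"
proof -
  let ?U = "{0<..<M} - snd ` set z"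
  \<comment> \<open>There are M - 1 = 3 * N + 2 rewarding states, and at most N of them are
    seen.\<close>
  have "2 * N + 2 \<le> card ?U"
    using diff_card_le_card_Diff[of "snd ` set z" "{0<..<M}"] card_seen_le(2)[OF assms(3)] assms(2)
    by simp
  then have "(2 * N + 2) * (6 * 4 ^ M) \<le> card ?U * (6 * 4 ^ M)"
    by (rule mult_right_mono) simp
  \<comment> \<open>The choice of M makes this exact: with p = 4 ^ M, the left side is the number of
    choices of \<open>c\<close> times M, the right side the guaranteed contribution of the unseen
    states.\<close>
  moreover have "4 * p * M = (2 * N + 2) * (6 * p)" for p
    unfolding assms(2) by (simp add: algebra_simps)
  then have "card ({..M} \<rightarrow>\<^sub>E {..<4::nat}) * M = (2 * N + 2) * (6 * 4 ^ M)"
    by (simp only: card_PiE[OF finite_atMost] prod_constant card_atMost card_lessThan power_Suc)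
  ultimately have "card ({..M} \<rightarrow>\<^sub>E {..<4::nat}) * M \<le> card ?U * (6 * 4 ^ M)"
    by (simp only:)
  then have "of_nat (card ({..M} \<rightarrow>\<^sub>E {..<4::nat}) * M) \<le> (of_nat (card ?U * (6 * 4 ^ M)) :: ennreal)"
    by (rule of_nat_mono)
  also have "\<dots> = (\<Sum>s\<in>?U. 6 * 4 ^ M)"
    by simp
  also have "\<dots> \<le> (\<Sum>s\<in>?U. \<Sum>c\<in>{..M} \<rightarrow>\<^sub>E {..<4}. miss (alg (observe c z)) s (c s))"
    using assms(1) card_seen_le(1)[OF assms(3)] by (intro sum_mono sum_miss_unseen[where \<gamma> = \<gamma>]) auto
  also have "\<dots> \<le> (\<Sum>s\<in>{0<..<M}. \<Sum>c\<in>{..M} \<rightarrow>\<^sub>E {..<4}. miss (alg (observe c z)) s (c s))"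
    by (intro sum_mono2) auto
  finally show ?thesis
    by (simp add: sum.swap[of _ "{0<..<M}"])
qed

text \<open>The bound holds for each sample after summing over the finitely many \<open>c\<close>.
  Exchanging that sum with the expectation shows that the worst \<open>c\<close> is at least as bad
  as the average.\<close>

lemma ex_hidden_actions:
  assumes "\<And>c D. length D = N \<Longrightarrow> alg D \<in> random_outputs (hard_game \<gamma> M c)" "M = 3 * N + 3"
  obtains c where "c \<in> {..M} \<rightarrow>\<^sub>E {..<4}"
    "of_nat M \<le> (\<integral>\<^sup>+z. (\<Sum>s\<in>{0<..<M}. miss (alg (observe c z)) s (c s)) \<partial>samples \<gamma> M N)"
proof -
  let ?C = "{..M} \<rightarrow>\<^sub>E {..<4::nat}"
  let ?W = "\<lambda>c. \<integral>\<^sup>+z. (\<Sum>s\<in>{0<..<M}. miss (alg (observe c z)) s (c s)) \<partial>samples \<gamma> M N"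
  have fin: "finite ?C" and card: "card ?C \<noteq> 0" and ne: "?C \<noteq> {}"
    by (auto simp: finite_PiE card_PiE PiE_eq_empty_iff lessThan_empty_iff)
  have "of_nat (card ?C) * of_nat M = (\<integral>\<^sup>+z. of_nat (card ?C) * of_nat M \<partial>samples \<gamma> M N)"
    by (simp add: measure_pmf.emeasure_space_1)
  also have "\<dots> \<le> (\<integral>\<^sup>+z. (\<Sum>c\<in>?C. \<Sum>s\<in>{0<..<M}. miss (alg (observe c z)) s (c s)) \<partial>samples \<gamma> M N)"
    using assms by (intro nn_integral_mono_AE AE_pmfI sum_miss_samples) auto
  also have "\<dots> = (\<Sum>c\<in>?C. ?W c)"
    by (rule nn_integral_sum) simp
  also have "\<dots> \<le> of_nat (card ?C) * Max (?W ` ?C)"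
    by (rule sum_bounded_above) (use fin in simp)
  finally have "of_nat M \<le> Max (?W ` ?C)"
    using card by (subst (asm) ennreal_mult_le_mult_iff) auto
  moreover have "Max (?W ` ?C) \<in> ?W ` ?C"
    using fin ne by (intro Max_in) auto
  ultimately show thesis
    using that by auto
qed

section \<open>From missed probability to the expected gap\<close>

lemma gap_hard_game_ge:
  assumes "0 < M" "0 \<le> \<gamma>" "\<gamma> < 1" "c \<in> {..M} \<rightarrow> {..<4}"
    and "best_response_choice (hard_game \<gamma> M c) \<mu>s \<nu>s"
    and "\<mu> \<in> policies {..M} {..4}" "\<nu> \<in> policies {..M} {..4}"
  shows "(\<Sum>s\<in>{0<..<M}. 2 - pmf (\<mu> s) (c s) - pmf (\<nu> s) (c s)) / (real M * (1 - \<gamma>))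
    \<le> init_avg (hard_game \<gamma> M c)
        (\<lambda>s. val (hard_game \<gamma> M c) (\<mu>s \<nu>) \<nu> s - val (hard_game \<gamma> M c) \<mu> (\<nu>s \<mu>) s)"
proof -
  let ?G = "hard_game \<gamma> M c" and ?e = "expert M c"
  \<comment> \<open>The expert policy competes with each best response, so it bounds both values
    from the right side, whichever best responses are selected.\<close>
  have "init_avg ?G (val ?G ?e \<nu>) \<le> init_avg ?G (val ?G (\<mu>s \<nu>) \<nu>)"
    "init_avg ?G (val ?G \<mu> (\<nu>s \<mu>)) \<le> init_avg ?G (val ?G \<mu> ?e)"
    using assms expert_in_policies[OF assms(4)]
    by (auto simp: best_response_choice_def br1_def br2_def)
  then have "init_avg ?G (val ?G ?e \<nu>) - init_avg ?G (val ?G \<mu> ?e)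
      \<le> init_avg ?G (\<lambda>s. val ?G (\<mu>s \<nu>) \<nu> s - val ?G \<mu> (\<nu>s \<mu>) s)"
    by (simp add: init_avg_def sum_subtractf right_diff_distrib)
  moreover have "(\<Sum>s\<in>{0<..<M}. 2 - pmf (\<mu> s) (c s) - pmf (\<nu> s) (c s))
      = 2 * real (M - 1) - agreement M c \<mu> - agreement M c \<nu>"
    by (simp add: sum_subtractf agreement_def)
  moreover have "init_avg ?G (val ?G ?e \<nu>) - init_avg ?G (val ?G \<mu> ?e)
      = (2 * real (M - 1) - agreement M c \<mu> - agreement M c \<nu>) / (real M * (1 - \<gamma>))"
    using assms(1-3) by (simp add: init_avg_val_hard_game agreement_expert diff_divide_distrib[symmetric])
  ultimately show ?thesis
    by (simp only:)
qed

text \<open>The selectors \<open>\<mu>s\<close> and \<open>\<nu>s\<close> are arbitrary, so the gap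
  need not be measurable in the output. It is therefore bounded by monotonicity alone; linearity of
  the integral is applied only to \<open>miss\<close>.\<close>

lemma nn_integral_gap_ge:
  assumes "0 < M" "0 \<le> \<gamma>" "\<gamma> < 1" "c \<in> {..M} \<rightarrow> {..<4}"
    and "best_response_choice (hard_game \<gamma> M c) \<mu>s \<nu>s"
    and Q: "Q \<in> random_outputs (hard_game \<gamma> M c)"
  shows "(\<Sum>s\<in>{0<..<M}. miss Q s (c s)) * ennreal (1 / (real M * (1 - \<gamma>)))
    \<le> (\<integral>\<^sup>+(\<mu>, \<nu>). ennreal (init_avg (hard_game \<gamma> M c)
        (\<lambda>s. val (hard_game \<gamma> M c) (\<mu>s \<nu>) \<nu> s - val (hard_game \<gamma> M c) \<mu> (\<nu>s \<mu>) s)) \<partial>Q)"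
proof -
  let ?k = "1 / (real M * (1 - \<gamma>))"
  let ?f = "\<lambda>s \<mu> \<nu>. 2 - pmf (\<mu> s) (c s) - pmf (\<nu> s) (c s)"
  have meas: "(\<lambda>(\<mu>, \<nu>). ennreal (?f s \<mu> \<nu>)) \<in> borel_measurable Q" if "s \<in> {0<..<M}" for s
    using that assms(4) by (intro random_outputs_hard_gameD(3)[OF Q]) (auto simp: Pi_iff less_imp_le)
  have "(\<Sum>s\<in>{0<..<M}. miss Q s (c s))
      = (\<integral>\<^sup>+x. (\<Sum>s\<in>{0<..<M}. case x of (\<mu>, \<nu>) \<Rightarrow> ennreal (?f s \<mu> \<nu>)) \<partial>Q)"
    unfolding miss_def by (rule nn_integral_sum[symmetric]) (rule meas)
  moreover have "(\<lambda>x. \<Sum>s\<in>{0<..<M}. case x of (\<mu>, \<nu>) \<Rightarrow> ennreal (?f s \<mu> \<nu>)) \<in> borel_measurable Q"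
    by (intro borel_measurable_sum meas)
  ultimately have "(\<Sum>s\<in>{0<..<M}. miss Q s (c s)) * ennreal ?k
      = (\<integral>\<^sup>+x. (\<Sum>s\<in>{0<..<M}. case x of (\<mu>, \<nu>) \<Rightarrow> ennreal (?f s \<mu> \<nu>)) * ennreal ?k \<partial>Q)"
    by (simp only: nn_integral_multc)
  also have "\<dots> \<le> (\<integral>\<^sup>+(\<mu>, \<nu>). ennreal (init_avg (hard_game \<gamma> M c)
        (\<lambda>s. val (hard_game \<gamma> M c) (\<mu>s \<nu>) \<nu> s - val (hard_game \<gamma> M c) \<mu> (\<nu>s \<mu>) s)) \<partial>Q)"
  proof (rule nn_integral_mono, clarify)
    fix \<mu> \<nu> assume "(\<mu>, \<nu>) \<in> space Q"
    then have pol: "\<mu> \<in> policies {..M} {..4}" "\<nu> \<in> policies {..M} {..4}"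
      by (auto simp: random_outputs_hard_gameD(2)[OF Q])
    have nonneg: "0 \<le> ?f s \<mu> \<nu>" for s
      using pmf_le_1[of "\<mu> s" "c s"] pmf_le_1[of "\<nu> s" "c s"] by simp
    then have "(\<Sum>s\<in>{0<..<M}. ennreal (?f s \<mu> \<nu>)) * ennreal ?k
        = ennreal ((\<Sum>s\<in>{0<..<M}. ?f s \<mu> \<nu>) / (real M * (1 - \<gamma>)))"
      using assms(2,3) by (subst sum_ennreal) (simp_all add: sum_nonneg flip: ennreal_mult)
    also have "\<dots> \<le> ennreal (init_avg (hard_game \<gamma> M c)
        (\<lambda>s. val (hard_game \<gamma> M c) (\<mu>s \<nu>) \<nu> s - val (hard_game \<gamma> M c) \<mu> (\<nu>s \<mu>) s))"
      by (intro ennreal_leI gap_hard_game_ge assms(1-5) pol)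
    finally show "(\<Sum>s\<in>{0<..<M}. ennreal (?f s \<mu> \<nu>)) * ennreal ?k \<le> \<dots>" .
  qed
  finally show ?thesis .
qed

lemma ex_hard_game:
  assumes "0 < \<gamma>" "\<gamma> < 1" "M = 3 * N + 3"
    and alg: "\<And>c D. length D = N \<Longrightarrow> alg D \<in> random_outputs (hard_game \<gamma> M c)"
  obtains c where "c \<in> {..M} \<rightarrow> {..<4}"
    and "\<And>\<mu>s \<nu>s. best_response_choice (hard_game \<gamma> M c) \<mu>s \<nu>s \<Longrightarrow>
      ennreal (1 / (1 - \<gamma>))
        \<le> expected_gap (hard_game \<gamma> M c) (expert M c) (expert M c) N alg \<mu>s \<nu>s"
proof -
  obtain c where "c \<in> {..M} \<rightarrow>\<^sub>E {..<4}"
    and W: "of_nat M \<le> (\<integral>\<^sup>+z. (\<Sum>s\<in>{0<..<M}. miss (alg (observe c z)) s (c s)) \<partial>samples \<gamma> M N)"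
    using ex_hidden_actions[where alg = alg, OF alg assms(3)] by blast
  then have c: "c \<in> {..M} \<rightarrow> {..<4}"
    by (simp add: PiE_iff)
  have M: "0 < M"
    using assms(3) by simp
  show thesis
  proof (rule that[OF c])
    fix \<mu>s \<nu>s assume choice: "best_response_choice (hard_game \<gamma> M c) \<mu>s \<nu>s"
    let ?k = "1 / (real M * (1 - \<gamma>))"
    \<comment> \<open>The M from the averaging argument cancels the 1 / M of the uniform initial
      law.\<close>
    have "ennreal (1 / (1 - \<gamma>)) = of_nat M * ennreal ?k"
      using M assms(2) by (simp add: ennreal_of_nat_eq_real_of_nat flip: ennreal_mult)
    also have "\<dots> \<le> (\<integral>\<^sup>+z. (\<Sum>s\<in>{0<..<M}. miss (alg (observe c z)) s (c s)) \<partial>samples \<gamma> M N) * ennreal ?k"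
      by (intro mult_right_mono W) simp
    also have "\<dots> = (\<integral>\<^sup>+z. (\<Sum>s\<in>{0<..<M}. miss (alg (observe c z)) s (c s)) * ennreal ?k \<partial>samples \<gamma> M N)"
      by (simp add: nn_integral_multc)
    also have "\<dots> \<le> expected_gap (hard_game \<gamma> M c) (expert M c) (expert M c) N alg \<mu>s \<nu>s"
      unfolding expected_gap_def dataset_expert[OF M c] nn_integral_map_pmf
      using M c assms(1,2) choice
      by (intro nn_integral_mono_AE AE_pmfI nn_integral_gap_ge alg) (auto simp: card_seen_le)
    finally show "ennreal (1 / (1 - \<gamma>))
      \<le> expected_gap (hard_game \<gamma> M c) (expert M c) (expert M c) N alg \<mu>s \<nu>s" .
  qed
qed

text \<open>\<open>view\<close> stands for what the learner is told about the game. It is constant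
  in \<open>c\<close>, so the learner is a fixed function of the data when \<open>c\<close> is
  chosen against it.\<close>

lemma ex_hard_game_view:
  fixes view :: "(nat, nat, nat) game \<Rightarrow> 'v"
  assumes \<gamma>: "0 < \<gamma>" "\<gamma> < 1"
    and view: "\<And>M c c'. view (hard_game \<gamma> M c) = view (hard_game \<gamma> M c')"
    and alg: "\<forall>G D. markov_game G \<and> length D = N \<longrightarrow> alg (view G) D \<in> random_outputs G"
  shows "\<exists>G \<mu>E \<nu>E.
    markov_game G \<and> disc G = \<gamma> \<and> nash G \<mu>E \<nu>E \<and> concentrability G \<mu>E \<nu>E = \<infinity> \<and>
    (\<forall>\<mu>s \<nu>s. best_response_choice G \<mu>s \<nu>s \<longrightarrow>
       ennreal (1 / (1 - \<gamma>)) \<le> expected_gap G \<mu>E \<nu>E N (alg (view G)) \<mu>s \<nu>s)"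
proof -
  define M where "M = 3 * N + 3"
  have M: "0 < M"
    by (simp add: M_def)
  \<comment> \<open>The constant 0 is an arbitrary representative; every other \<open>c\<close>
    gives the same view.\<close>
  let ?alg = "alg (view (hard_game \<gamma> M (\<lambda>_. 0)))"
  have "?alg D \<in> random_outputs (hard_game \<gamma> M c)" if "length D = N" for c D
    using alg that markov_game_hard_game[OF M, of \<gamma> c] \<gamma> view[of M c "\<lambda>_. 0"] by (metis less_imp_le)
  then obtain c where c: "c \<in> {..M} \<rightarrow> {..<4}"
    and gap: "\<And>\<mu>s \<nu>s. best_response_choice (hard_game \<gamma> M c) \<mu>s \<nu>s \<Longrightarrow>
      ennreal (1 / (1 - \<gamma>))
        \<le> expected_gap (hard_game \<gamma> M c) (expert M c) (expert M c) N ?alg \<mu>s \<nu>s"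
    using ex_hard_game[where alg = ?alg, OF \<gamma> M_def] by metis
  show ?thesis
    using \<gamma> M c gap unfolding view[of M "\<lambda>_. 0" c]
    by (intro exI[of _ "hard_game \<gamma> M c"] exI[of _ "expert M c"])
      (simp add: markov_game_hard_game nash_expert concentrability_expert)
qed

theorem theorem3p2:
  fixes \<gamma> :: real and N :: nat
  assumes "0 < \<gamma>" and "\<gamma> < 1"
  shows "(\<forall>alg :: (nat, nat, nat) env \<Rightarrow> (nat \<times> nat \<times> nat) list list \<Rightarrow>
              ((nat \<Rightarrow> nat pmf) \<times> (nat \<Rightarrow> nat pmf)) measure.
            (\<forall>G D. markov_game G \<and> length D = N \<longrightarrow>
               alg (env.truncate G) D \<in> random_outputs G) \<longrightarrow>
            (\<exists>G \<mu>E \<nu>E.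
               markov_game G \<and> disc G = \<gamma> \<and> nash G \<mu>E \<nu>E \<and> concentrability G \<mu>E \<nu>E = \<infinity> \<and>
               (\<forall>\<mu>s \<nu>s. best_response_choice G \<mu>s \<nu>s \<longrightarrow>
                  ennreal (1 / (1 - \<gamma>))
                    \<le> expected_gap G \<mu>E \<nu>E N (alg (env.truncate G)) \<mu>s \<nu>s)))
       \<and> (\<forall>alg :: (nat, nat, nat) dyn \<Rightarrow> (nat \<times> nat \<times> nat) list list \<Rightarrow>
              ((nat \<Rightarrow> nat pmf) \<times> (nat \<Rightarrow> nat pmf)) measure.
            (\<forall>G D. markov_game G \<and> length D = N \<longrightarrow>
               alg (dyn.truncate G) D \<in> random_outputs G) \<longrightarrow>
            (\<exists>G \<mu>E \<nu>E.
               markov_game G \<and> disc G = \<gamma> \<and> nash G \<mu>E \<nu>E \<and> concentrability G \<mu>E \<nu>E = \<infinity> \<and>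
               (\<forall>\<mu>s \<nu>s. best_response_choice G \<mu>s \<nu>s \<longrightarrow>
                  ennreal (1 / (1 - \<gamma>))
                    \<le> expected_gap G \<mu>E \<nu>E N (alg (dyn.truncate G)) \<mu>s \<nu>s)))"
proof (intro conjI allI impI, goal_cases)
  case (1 alg)
  then show ?case
    by (rule ex_hard_game_view[where view = env.truncate, OF assms truncate_hard_game(1)])
next
  case (2 alg)
  then show ?case
    by (rule ex_hard_game_view[where view = dyn.truncate, OF assms truncate_hard_game(2)])
qed

end
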